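(* Consider a continuous-time nearest-neighbor random walk on the ring $\frac1N\mathbb{Z}_N$ with $N\ge 3$ vertices $0,\frac1N,\dots,\frac{N-1}N$ (addition modulo $1$), with strictly positive transition rates $k(x,x+\frac1N)$ and $k(x,x-\frac1N)$, all other transitions being forbidden. Let $L$ be its backward generator, $\rho^s$ its unique stationary probability distribution, and let $f:\frac1N\mathbb{Z}_N\to\mathbb{R}$ satisfy $\langle f\rangle^s=\sum_x\rho^s(x)f(x)=0$. Let $V_f=\int_0^\infty e^{tL}f\,dt$ be the quasipotential of $f$. Then for every vertex $x$, $$V_f(x)=\frac{\sum_y w\left(\mathcal{F}^{x\to y}\right)f(y)}{w(\mathcal{T})},$$ where the sum runs over all vertices $y$, $w(\mathcal{T})$ is the total weight of all rooted trees in the ring, and $w(\mathcal{F}^{x\to y})$ is the total weight of all double rooted trees in the ring for which $y$ is one of the two roots and $x$ lies in the same part as $y$.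
   Context: Generator. $L$ acts on functions $g$ on $\frac1N\mathbb{Z}_N$ by $$Lg(x)=k(x,x+\tfrac1N)\big(g(x+\tfrac1N)-g(x)\big)+k(x,x-\tfrac1N)\big(g(x-\tfrac1N)-g(x)\big).$$ The stationary distribution $\rho^s>0$ is the unique probability row vector with $\rho^sL=0$. The integral defining $V_f$ converges exponentially fast when $\langle f\rangle^s=0$. Trees. The ring is the cycle graph with edges $\{x,x+\frac1N\}$. A tree in the ring is the ring with exactly one edge removed. A double tree in the ring is the ring with exactly two edges removed; it consists of two connected parts, one of which may be a single vertex. Rooted trees. A rooted tree in the ring is a tree in the ring in which a vertex (the root) is singled out and every edge is given a direction so that, following the directions from an arbitrary vertex, one ends up in the root. A double rooted tree in the ring is a double tree in the ring in which each of the two parts has a singled-out vertex (its root) and every edge is given a direction so that, following the directions from an arbitrary vertex of a part, one ends up in the root of that part. Sets and weights. $\mathcal{T}$ is the set of all rooted trees in the ring (all removed edges, all roots). $\mathcal{F}^{x\to y}$ is the set of all double rooted trees in the ring such that $y$ is one of the roots and $x$ is in the same part as $y$ (the root of the other part is arbitrary; $x=y$ is allowed). The weight $w(T)$ of a rooted tree, or $w(F)$ of a double rooted tree, is the product of the rates $k(z,u)$ over all its directed edges $z\to u$ (with $u=z\pm\frac1N$). For a set $S$ of rooted or double rooted trees, $w(S)=\sum_{s\in S}w(s)$. *)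

theory Defs
  imports "HOL-Analysis.Analysis"
begin

text \<open>
  The vertex \<open>i/N\<close> of the ring \<open>(1/N)\<int>\<^sub>N\<close> is represented by the natural number \<open>i < N\<close>.  Functions on
  the ring are functions on \<^typ>\<open>nat\<close> of which only the values below \<open>N\<close> matter.
\<close>

definition ring_next :: "nat \<Rightarrow> nat \<Rightarrow> nat" where
  "ring_next N x = (x + 1) mod N"

definition ring_prev :: "nat \<Rightarrow> nat \<Rightarrow> nat" where
  "ring_prev N x = (x + (N - 1)) mod N"


subsection \<open>The walk\<close>

definition generator :: "nat \<Rightarrow> (nat \<Rightarrow> nat \<Rightarrow> real) \<Rightarrow> (nat \<Rightarrow> real) \<Rightarrow> nat \<Rightarrow> real" where
  "generator N k g x =
     k x (ring_next N x) * (g (ring_next N x) - g x) +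
     k x (ring_prev N x) * (g (ring_prev N x) - g x)"

text \<open>The matrix entry \<open>L(x,y)\<close> is \<open>L\<close> applied to the indicator function of \<open>y\<close>, evaluated at \<open>x\<close>.\<close>

definition stationary_distribution :: "nat \<Rightarrow> (nat \<Rightarrow> nat \<Rightarrow> real) \<Rightarrow> (nat \<Rightarrow> real) \<Rightarrow> bool" where
  "stationary_distribution N k \<rho> \<longleftrightarrow>
     (\<forall>x<N. 0 \<le> \<rho> x) \<and> (\<Sum>x<N. \<rho> x) = 1 \<and>
     (\<forall>y<N. (\<Sum>x<N. \<rho> x * generator N k (indicator {y}) x) = 0)"

text \<open>\<open>(e\<^sup>t\<^sup>L g)(x)\<close> by the exponential series of the operator \<open>L\<close>.\<close>

definition semigroup_exp ::
    "nat \<Rightarrow> (nat \<Rightarrow> nat \<Rightarrow> real) \<Rightarrow> real \<Rightarrow> (nat \<Rightarrow> real) \<Rightarrow> nat \<Rightarrow> real" where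
  "semigroup_exp N k t g x = (\<Sum>n. t ^ n / fact n * (generator N k ^^ n) g x)"

definition quasipotential :: "nat \<Rightarrow> (nat \<Rightarrow> nat \<Rightarrow> real) \<Rightarrow> (nat \<Rightarrow> real) \<Rightarrow> nat \<Rightarrow> real" where
  "quasipotential N k f x = integral {0..} (\<lambda>t. semigroup_exp N k t f x)"


subsection \<open>Trees and double trees in the ring\<close>

text \<open>
  All subgraphs are spanning, so they are given by their sets of undirected edges.  For \<open>N \<ge> 3\<close> the
  ring has exactly \<open>N\<close> edges.
\<close>

definition ring_edges :: "nat \<Rightarrow> nat set set" where
  "ring_edges N = {{x, ring_next N x} |x. x < N}"

definition ring_tree :: "nat \<Rightarrow> nat set set \<Rightarrow> bool" where
  "ring_tree N E \<longleftrightarrow> (\<exists>e\<in>ring_edges N. E = ring_edges N - {e})"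

definition ring_double_tree :: "nat \<Rightarrow> nat set set \<Rightarrow> bool" where
  "ring_double_tree N E \<longleftrightarrow>
     (\<exists>e\<in>ring_edges N. \<exists>e'\<in>ring_edges N. e \<noteq> e' \<and> E = ring_edges N - {e, e'})"

definition same_part :: "nat set set \<Rightarrow> nat \<Rightarrow> nat \<Rightarrow> bool" where
  "same_part E x y \<longleftrightarrow> (x, y) \<in> {(u, v). {u, v} \<in> E}\<^sup>*"

definition undirected :: "nat \<times> nat \<Rightarrow> nat set" where
  "undirected = (\<lambda>(z, u). {z, u})"

text \<open>The pair \<open>(z, u)\<close> is the directed edge from \<open>z\<close> to \<open>u\<close>; every edge receives exactly one direction.\<close>

definition orientation :: "(nat \<times> nat) set \<Rightarrow> nat set set \<Rightarrow> bool" where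
  "orientation D E \<longleftrightarrow> bij_betw undirected D E"

text \<open>
  A rooted tree is a pair of its set of directed edges and its root; a double rooted tree is a pair
  of its set of directed edges and the set of its roots, one in each part.
\<close>

definition rooted_trees :: "nat \<Rightarrow> ((nat \<times> nat) set \<times> nat) set" where
  "rooted_trees N =
     {(D, r). r < N \<and>
        (\<exists>E. ring_tree N E \<and> orientation D E \<and> (\<forall>z<N. (z, r) \<in> D\<^sup>*))}"

definition double_rooted_trees :: "nat \<Rightarrow> ((nat \<times> nat) set \<times> nat set) set" where
  "double_rooted_trees N =
     {(D, R). R \<subseteq> {..<N} \<and>
        (\<exists>E. ring_double_tree N E \<and> orientation D E \<and>
             (\<forall>z<N. \<exists>!r. r \<in> R \<and> same_part E z r) \<and>
             (\<forall>z<N. \<forall>r\<in>R. same_part E z r \<longrightarrow> (z, r) \<in> D\<^sup>*))}"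

definition double_rooted_trees_to ::
    "nat \<Rightarrow> nat \<Rightarrow> nat \<Rightarrow> ((nat \<times> nat) set \<times> nat set) set" where
  "double_rooted_trees_to N x y =
     {(D, R) \<in> double_rooted_trees N. y \<in> R \<and> same_part (undirected ` D) x y}"

definition weight :: "(nat \<Rightarrow> nat \<Rightarrow> real) \<Rightarrow> (nat \<times> nat) set \<Rightarrow> real" where
  "weight k D = (\<Prod>(z, u)\<in>D. k z u)"

definition total_weight :: "(nat \<Rightarrow> nat \<Rightarrow> real) \<Rightarrow> ((nat \<times> nat) set \<times> 'r) set \<Rightarrow> real" where
  "total_weight k S = (\<Sum>(D, r)\<in>S. weight k D)"

text \<open>The sets of rooted and double rooted trees are finite, so that their total weights are genuine sums.\<close>

lemma orientation_subset:
  assumes "orientation D E" "E \<subseteq> ring_edges N"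
  shows "D \<subseteq> {..<N} \<times> {..<N}"
proof
  fix p assume "p \<in> D"
  then have "undirected p \<in> ring_edges N"
    using assms unfolding orientation_def bij_betw_def by blast
  then show "p \<in> {..<N} \<times> {..<N}"
    by (cases p) (auto simp: undirected_def ring_edges_def ring_next_def doubleton_eq_iff)
qed

lemma finite_rooted_trees: "finite (rooted_trees N)"
proof (rule finite_subset)
  show "rooted_trees N \<subseteq> Pow ({..<N} \<times> {..<N}) \<times> {..<N}"
    using orientation_subset by (fastforce simp: rooted_trees_def ring_tree_def)
qed simp

lemma finite_double_rooted_trees: "finite (double_rooted_trees N)"
proof (rule finite_subset)
  show "double_rooted_trees N \<subseteq> Pow ({..<N} \<times> {..<N}) \<times> Pow {..<N}"
    using orientation_subset by (fastforce simp: double_rooted_trees_def ring_double_tree_def)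
qed simp

end

theory Submission
  imports Defs
begin

text \<open>
  Let \<open>W\<^sub>m\<close> be the matrix whose entry \<open>(x, y)\<close> is the total weight of the rooted forests with \<open>m\<close> arcs in
  which \<open>y\<close> is a root reached from \<open>x\<close>, and \<open>\<sigma>\<^sub>m\<close> the total weight of all forests with \<open>m\<close> arcs.
  Exchanging the arc out of \<open>x\<close> gives \<open>W\<^sub>m\<^sub>+\<^sub>1 = L W\<^sub>m + \<sigma>\<^sub>m\<^sub>+\<^sub>1\<close>, so every \<open>W\<^sub>m\<close> is a polynomial in \<open>L\<close> and
  commutes with it.  The rows of \<open>W\<^sub>N\<^sub>-\<^sub>1\<close> are all equal, whence they are \<open>\<sigma>\<^sub>N\<^sub>-\<^sub>1 \<rho>\<close>.  For
  \<open>u(t) = e\<^sup>t\<^sup>L f\<close> with \<open>\<langle>f\<rangle> = 0\<close> this yields \<open>d/dt W\<^sub>N\<^sub>-\<^sub>2 u = L W\<^sub>N\<^sub>-\<^sub>2 u = - \<sigma>\<^sub>N\<^sub>-\<^sub>1 u\<close>, which is integrated over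
  time; \<open>u\<close> decays exponentially by a Poincare inequality for the Dirichlet form.
\<close>

subsection \<open>Rooted forests\<close>

lemma rtrancl_from_terminal:
  assumes "x \<notin> Domain D"
  shows "(x, z) \<in> D\<^sup>* \<longleftrightarrow> x = z"
  using assms by (auto elim: converse_rtranclE)

text \<open>Two paths from one point of a single-valued relation are nested, so one of
  \<open>r\<close>, \<open>s\<close> reaches the other, and a terminal point reaches only
  itself.\<close>

lemma single_valued_rtrancl_terminal_unique:
  assumes "single_valued D" "(z, r) \<in> D\<^sup>*" "(z, s) \<in> D\<^sup>*" "r \<notin> Domain D" "s \<notin> Domain D"
  shows "r = s"
proof -
  have "(r, s) \<in> D\<^sup>* \<or> (s, r) \<in> D\<^sup>*"
    using single_valued_confluent[OF assms(1-3)] .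
  then show ?thesis
    using rtrancl_from_terminal[OF assms(4)] rtrancl_from_terminal[OF assms(5)] by auto
qed

lemma single_valued_step_towards_terminal:
  assumes "single_valued D" "(z, u) \<in> D" "(z, r) \<in> D\<^sup>*" "r \<notin> Domain D"
  shows "(u, r) \<in> D\<^sup>*"
  using assms by (metis Domain.DomainI converse_rtranclE single_valuedD)

text \<open>In a single-valued relation no path leaves a cycle, so a point on a cycle could not
  reach a terminal point.\<close>

lemma acyclic_if_reaches_terminal:
  assumes sv: "single_valued D"
    and reach: "\<And>z. z \<in> Domain D \<Longrightarrow> \<exists>r. (z, r) \<in> D\<^sup>* \<and> r \<notin> Domain D"
  shows "acyclic D"
proof (rule acyclicI, intro allI notI)
  fix a assume cyc: "(a, a) \<in> D\<^sup>+"
  then have "a \<in> Domain D"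
    by (metis Domain.DomainI tranclD)
  then obtain r where r: "(a, r) \<in> D\<^sup>*" "r \<notin> Domain D"
    using reach by blast
  \<comment> \<open>Everything reachable from \<open>a\<close> leads back to \<open>a\<close>; for
    \<open>b = r\<close> this contradicts that \<open>r\<close> has no outgoing arc.\<close>
  have "(b, a) \<in> D\<^sup>+" if "(a, b) \<in> D\<^sup>*" for b
    using that
  proof (induction rule: rtrancl_induct)
    case base show ?case by (rule cyc)
  next
    case (step b c)
    obtain d where "(b, d) \<in> D" "(d, a) \<in> D\<^sup>*"
      using step.IH by (meson tranclD)
    then have "(c, a) \<in> D\<^sup>*"
      using step.hyps(2) sv by (metis single_valuedD)
    then show ?case using cyc by (rule rtrancl_trancl_trancl)
  qed
  then show False
    using r by (metis Domain.DomainI tranclD)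
qed

text \<open>Following arcs must stop, since the converse of a finite acyclic relation is
  well-founded.\<close>

lemma acyclic_reaches_terminal:
  assumes "finite D" "acyclic D"
  shows "\<exists>r. (z, r) \<in> D\<^sup>* \<and> r \<notin> Domain D"
proof -
  have "wf (D\<inverse>)"
    using assms by (rule finite_acyclic_wf_converse)
  then show ?thesis
  proof (induction z rule: wf_induct_rule)
    case (less z)
    show ?case
    proof (cases "z \<in> Domain D")
      case True
      then obtain u where "(z, u) \<in> D" by blast
      then show ?thesis using less by (meson converseI converse_rtrancl_into_rtrancl)
    qed auto
  qed
qed

lemma card_Domain_single_valued:
  assumes "single_valued D"
  shows "card (Domain D) = card D"
proof -
  have "inj_on fst D"
    using assms by (auto simp: inj_on_def single_valued_def)
  then show ?thesis by (simp add: Domain_fst card_image)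
qed

text \<open>
  A rooted forest is encoded by its arcs: every vertex has at most one outgoing arc, and the roots
  are the vertices with none.
\<close>

definition forests :: "(nat \<times> nat) set \<Rightarrow> nat \<Rightarrow> (nat \<times> nat) set set" where
  "forests A m = {D. D \<subseteq> A \<and> single_valued D \<and> acyclic D \<and> card D = m}"

definition forests_weight :: "(nat \<Rightarrow> nat \<Rightarrow> real) \<Rightarrow> (nat \<times> nat) set \<Rightarrow> nat \<Rightarrow> real" where
  "forests_weight k A m = (\<Sum>D\<in>forests A m. weight k D)"

text \<open>On the ring this is the entry \<open>(x, y)\<close> of \<open>W\<^sub>m\<close>, the
  coefficient of \<open>\<lambda>^(N - 1 - m)\<close> in \<open>adj(\<lambda> - L)\<close>.\<close>

definition forests_weight_to ::
    "(nat \<Rightarrow> nat \<Rightarrow> real) \<Rightarrow> (nat \<times> nat) set \<Rightarrow> nat \<Rightarrow> nat \<Rightarrow> nat \<Rightarrow> real" where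
  "forests_weight_to k A m x y =
     (\<Sum>D\<in>forests A m. weight k D * of_bool ((x, y) \<in> D\<^sup>* \<and> y \<notin> Domain D))"

lemma finite_forests: "finite A \<Longrightarrow> finite (forests A m)"
  by (rule finite_subset[of _ "Pow A"]) (auto simp: forests_def)

lemma forests_0: "finite A \<Longrightarrow> forests A 0 = {{}}"
  by (auto simp: forests_def acyclic_def dest: finite_subset)

text \<open>A forest with an arc out of \<open>x\<close> is, in a unique way, a forest
  \<open>E\<close> with root \<open>x\<close> plus an arc \<open>(x, v)\<close>; the arc closes no
  cycle exactly when \<open>v\<close> does not lead to \<open>x\<close> in \<open>E\<close>.\<close>

lemma sum_forests_split_vertex:
  fixes g :: "(nat \<times> nat) set \<Rightarrow> real"
  assumes A: "finite A"
  shows "(\<Sum>D\<in>forests A (Suc m). g D) =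
    (\<Sum>D | D \<in> forests A (Suc m) \<and> x \<notin> Domain D. g D) +
    (\<Sum>E | E \<in> forests A m \<and> x \<notin> Domain E. \<Sum>v | (x, v) \<in> A \<and> (v, x) \<notin> E\<^sup>*. g (insert (x, v) E))"
proof -
  let ?F = "forests A (Suc m)"
  let ?S = "SIGMA E:{E. E \<in> forests A m \<and> x \<notin> Domain E}. {v. (x, v) \<in> A \<and> (v, x) \<notin> E\<^sup>*}"
  have fin: "finite D" if "D \<subseteq> A" for D
    using that A by (rule finite_subset)
  have finv: "finite {v. (x, v) \<in> A \<and> P v}" for P
    by (rule finite_subset[of _ "snd ` A"]) (use A in force)+
  have "bij_betw (\<lambda>(E, v). insert (x, v) E) ?S {D \<in> ?F. x \<in> Domain D}"
  proof (rule bij_betw_imageI)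
    show "inj_on (\<lambda>(E, v). insert (x, v) E) ?S"
    proof (rule inj_onI, clarify)
      fix E v E' v'
      assume E: "x \<notin> Domain E" "x \<notin> Domain E'" and eq: "insert (x, v) E = insert (x, v') E'"
      then have "(x, v) \<in> insert (x, v') E'" by blast
      then have "v = v'" using E by blast
      moreover have "(x, v) \<notin> E" "(x, v') \<notin> E'" using E by blast+
      ultimately show "E = E' \<and> v = v'" using eq by (simp add: insert_ident)
    qed
    show "(\<lambda>(E, v). insert (x, v) E) ` ?S = {D \<in> ?F. x \<in> Domain D}"
    proof (intro equalityI subsetI)
      fix D assume "D \<in> (\<lambda>(E, v). insert (x, v) E) ` ?S"
      then obtain E v where D: "D = insert (x, v) E" and E: "E \<in> forests A m" "x \<notin> Domain E"
        and v: "(x, v) \<in> A" "(v, x) \<notin> E\<^sup>*" by auto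
      have "(x, v) \<notin> E" using E(2) by blast
      moreover have "finite E" using E(1) fin by (simp add: forests_def)
      moreover have "single_valued D"
        using E unfolding D by (auto simp: forests_def single_valued_def)
      ultimately show "D \<in> {D \<in> ?F. x \<in> Domain D}"
        using E v by (simp add: D forests_def acyclic_insert)
    next
      fix D assume "D \<in> {D \<in> ?F. x \<in> Domain D}"
      then obtain v where D: "D \<in> ?F" and v: "(x, v) \<in> D" by blast
      let ?E = "D - {(x, v)}"
      have ins: "D = insert (x, v) ?E" using v by blast
      have "single_valued D" "acyclic D" "D \<subseteq> A" "card D = Suc m"
        using D by (auto simp: forests_def)
      have "x \<notin> Domain ?E"
        using v \<open>single_valued D\<close> by (auto dest: single_valuedD)
      moreover have "acyclic ?E \<and> (v, x) \<notin> ?E\<^sup>*"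
        using \<open>acyclic D\<close> ins acyclic_insert by metis
      moreover have "single_valued ?E"
        using \<open>single_valued D\<close> by (rule single_valued_subset[rotated]) blast
      moreover have "card ?E = m"
        using v \<open>card D = Suc m\<close> by simp
      ultimately have "(?E, v) \<in> ?S"
        using \<open>D \<subseteq> A\<close> v by (auto simp: forests_def)
      then show "D \<in> (\<lambda>(E, v). insert (x, v) E) ` ?S"
        using ins by (intro image_eqI[of _ _ "(?E, v)"]) auto
    qed
  qed
  then have "(\<Sum>D | D \<in> ?F \<and> x \<in> Domain D. g D) = (\<Sum>(E, v)\<in>?S. g (insert (x, v) E))"
    by (subst sum.reindex_bij_betw[symmetric]) (auto simp: case_prod_unfold)
  also have "\<dots> = (\<Sum>E | E \<in> forests A m \<and> x \<notin> Domain E.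
      \<Sum>v | (x, v) \<in> A \<and> (v, x) \<notin> E\<^sup>*. g (insert (x, v) E))"
    using finite_forests[OF A, of m] finv by (subst sum.Sigma) auto
  finally have in_dom: "(\<Sum>D | D \<in> ?F \<and> x \<in> Domain D. g D) = \<dots>" .
  have "?F = {D \<in> ?F. x \<notin> Domain D} \<union> {D \<in> ?F. x \<in> Domain D}"
    by blast
  then have "(\<Sum>D\<in>?F. g D) = (\<Sum>D | D \<in> ?F \<and> x \<notin> Domain D. g D) + (\<Sum>D | D \<in> ?F \<and> x \<in> Domain D. g D)"
    using finite_forests[OF A, of "Suc m"] by (subst sum.union_disjoint[symmetric]) auto
  then show ?thesis using in_dom by simp
qed

lemma weight_insert:
  assumes "finite E" "x \<notin> Domain E"
  shows "weight k (insert (x, v) E) = k x v * weight k E"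
proof -
  have "(x, v) \<notin> E" using assms(2) by blast
  then show ?thesis using assms(1) by (simp add: weight_def)
qed

lemma sum_antisymmetric_zero:
  fixes c :: "'a \<Rightarrow> real"
  assumes "\<And>u v. u \<in> U \<Longrightarrow> v \<in> U \<Longrightarrow> h u v = - h v u"
  shows "(\<Sum>u\<in>U. \<Sum>v\<in>U. c u * c v * h u v) = 0"
proof -
  have "(\<Sum>u\<in>U. \<Sum>v\<in>U. c u * c v * h u v) = (\<Sum>v\<in>U. \<Sum>u\<in>U. c u * c v * h u v)"
    by (rule sum.swap)
  also have "\<dots> = (\<Sum>v\<in>U. \<Sum>u\<in>U. - (c v * c u * h v u))"
    by (intro sum.cong refl) (metis assms minus_mult_right mult.commute)
  finally show ?thesis by (simp add: sum_negf)
qed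

text \<open>
  This is the coefficient identity behind \<open>(\<lambda> - L) adj(\<lambda> - L) = det(\<lambda> - L)\<close>.  Grouping the forests by
  what remains once the arc out of \<open>x\<close> is deleted, the forests in which \<open>x\<close> has an arc contribute an
  expression antisymmetric in the deleted arc \<open>(x, v)\<close> and the arc \<open>(x, u)\<close> of the generator.
\<close>

lemma forests_weight_to_generator:
  assumes A: "finite A"
  shows "(\<Sum>u\<in>A `` {x}. k x u * (forests_weight_to k A m u y - forests_weight_to k A m x y)) =
    forests_weight_to k A (Suc m) x y - of_bool (x = y) * forests_weight k A (Suc m)"
proof -
  define U where "U = A `` {x}"
  define G where "G m = {D. D \<in> forests A m \<and> x \<notin> Domain D}" for m
  define J where "J D u = (of_bool ((u, y) \<in> D\<^sup>* \<and> y \<notin> Domain D) :: real)" for D u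
  have finU: "finite U" unfolding U_def using A by (rule finite_Image)
  have U: "{v. (x, v) \<in> A \<and> P v} = {v \<in> U. P v}" for P
    by (auto simp: U_def)
  have GD: "x \<notin> Domain E" "finite E" "single_valued E" if "E \<in> G m" for E m
    using that A by (auto simp: G_def forests_def dest: finite_subset)
  have decomp: "(\<Sum>D\<in>forests A (Suc m). weight k D * h D) = (\<Sum>D\<in>G (Suc m). weight k D * h D) +
      (\<Sum>E\<in>G m. weight k E * (\<Sum>v\<in>U. k x v * (of_bool ((v, x) \<notin> E\<^sup>*) * h (insert (x, v) E))))" for m h
    unfolding sum_forests_split_vertex[OF A, where x = x] G_def[symmetric] U sum_distrib_left
    by (intro arg_cong2[where f = "(+)"] refl sum.cong sum.mono_neutral_cong_left finU)
       (auto simp: weight_insert GD)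
  \<comment> \<open>Here \<open>x\<close> is a root of \<open>D\<close>. If \<open>u\<close> leads
    to \<open>x\<close>, both have root \<open>x\<close> and the difference vanishes; otherwise
    adding the arc \<open>(x, u)\<close> gives \<open>x\<close> the root of
    \<open>u\<close>.\<close>
  have T: "(\<Sum>u\<in>U. k x u * (J D u - J D x)) =
      (\<Sum>v\<in>U. k x v * (of_bool ((v, x) \<notin> D\<^sup>*) * (J (insert (x, v) D) x - of_bool (x = y)))) "
    if D: "D \<in> G n" for D n
  proof (intro sum.cong refl arg_cong2[where f = "(*)"])
    fix u
    have *: "(x, z) \<in> D\<^sup>* \<longleftrightarrow> x = z" for z
      using GD(1)[OF D] by (rule rtrancl_from_terminal)
    show "J D u - J D x = of_bool ((u, x) \<notin> D\<^sup>*) * (J (insert (x, u) D) x - of_bool (x = y))"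
    proof (cases "x = y")
      case True
      then show ?thesis using GD(1)[OF D] by (auto simp: J_def)
    next
      case False
      show ?thesis
      proof (cases "(u, x) \<in> D\<^sup>*")
        case True
        then have "(u, y) \<in> D\<^sup>* \<Longrightarrow> y \<in> Domain D"
          using False single_valued_rtrancl_terminal_unique[OF GD(3)[OF D], of u x y] GD(1)[OF D] by blast
        then have "J D u = 0" by (auto simp: J_def)
        then show ?thesis using True False by (auto simp: J_def *)
      next
        case nx: False
        then show ?thesis using False GD(1)[OF D]
          by (auto simp: J_def * rtrancl_insert)
      qed
    qed
  qed
  \<comment> \<open>By \<open>T\<close>, the forests with root \<open>x\<close> already account for
    the whole right-hand side.\<close>
  have main: "(\<Sum>D\<in>G m. weight k D * (\<Sum>u\<in>U. k x u * (J D u - J D x))) =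
     forests_weight_to k A (Suc m) x y - of_bool (x = y) * forests_weight k A (Suc m)"
  proof -
    have "forests_weight_to k A (Suc m) x y - of_bool (x = y) * forests_weight k A (Suc m)
       = (\<Sum>D\<in>forests A (Suc m). weight k D * (J D x - of_bool (x = y)))"
      by (simp add: forests_weight_to_def forests_weight_def J_def right_diff_distrib sum_subtractf sum_distrib_left mult.commute)
    also have "\<dots> = (\<Sum>D\<in>G (Suc m). weight k D * (J D x - of_bool (x = y))) +
        (\<Sum>E\<in>G m. weight k E * (\<Sum>u\<in>U. k x u * (J E u - J E x)))"
      unfolding decomp by (intro arg_cong2[where f = "(+)"] refl sum.cong) (use T in auto)
    also have "(\<Sum>D\<in>G (Suc m). weight k D * (J D x - of_bool (x = y))) = 0"
    proof (intro sum.neutral ballI)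
      fix D assume "D \<in> G (Suc m)"
      then have "x \<notin> Domain D" by (rule GD)
      then have "J D x = of_bool (x = y)"
        by (auto simp: J_def rtrancl_from_terminal)
      then show "weight k D * (J D x - of_bool (x = y)) = 0" by simp
    qed
    finally show ?thesis by simp
  qed
  have "(\<Sum>u\<in>U. k x u * (forests_weight_to k A m u y - forests_weight_to k A m x y)) =
      (\<Sum>D\<in>forests A m. weight k D * (\<Sum>u\<in>U. k x u * (J D u - J D x)))"
    unfolding forests_weight_to_def J_def[symmetric] sum_subtractf[symmetric] sum_distrib_left
    by (subst sum.swap) (simp add: algebra_simps)
  \<comment> \<open>It remains to see that the forests in which \<open>x\<close> has an arc
    contribute nothing; for \<open>m = 0\<close> there are none.\<close>
  also have "\<dots> = (\<Sum>D\<in>G m. weight k D * (\<Sum>u\<in>U. k x u * (J D u - J D x)))"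
  proof (cases m)
    case 0
    have "G 0 = forests A 0" using A by (auto simp: G_def forests_0)
    then show ?thesis using 0 by simp
  next
    case (Suc n)
    have "(\<Sum>v\<in>U. k x v * (of_bool ((v, x) \<notin> E\<^sup>*) *
        (\<Sum>u\<in>U. k x u * (J (insert (x, v) E) u - J (insert (x, v) E) x)))) = 0"
      if E: "E \<in> G n" for E
    proof -
      have *: "(x, z) \<in> E\<^sup>* \<longleftrightarrow> x = z" for z
        using GD(1)[OF E] by (rule rtrancl_from_terminal)
      \<comment> \<open>If neither \<open>u\<close> nor \<open>v\<close> leads to \<open>x\<close>
        in \<open>E\<close>, then \<open>?h v u\<close> is the indicator that \<open>u\<close> leads
        to \<open>y\<close> minus the same for \<open>v\<close>. If one of them does,
        \<open>?h v u\<close> and \<open>?h u v\<close> both vanish: either the new arc would close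
        a cycle, or it puts \<open>u\<close>, \<open>v\<close> and \<open>x\<close> in one
        tree.\<close>
      let ?h = "\<lambda>v u. of_bool ((v, x) \<notin> E\<^sup>*) * (J (insert (x, v) E) u - J (insert (x, v) E) x)"
      have "?h v u = - ?h u v" for u v
      proof (cases "x = y \<or> y \<in> Domain E")
        case True
        then show ?thesis by (auto simp: J_def)
      next
        case False
        have "z \<in> {u, v} \<Longrightarrow> (z, x) \<in> E\<^sup>* \<Longrightarrow> (z, y) \<notin> E\<^sup>*" for z
          using False single_valued_rtrancl_terminal_unique[OF GD(3)[OF E], of z x y] GD(1)[OF E] by blast
        from this[of u] this[of v] show ?thesis
          using False GD(1)[OF E] by (auto simp: J_def * rtrancl_insert)
      qed
      then have "(\<Sum>v\<in>U. \<Sum>u\<in>U. k x v * k x u * ?h v u) = 0"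
        by (intro sum_antisymmetric_zero)
      then show ?thesis by (simp add: sum_distrib_left mult_ac)
    qed
    then show ?thesis unfolding Suc decomp by simp
  qed
  also note main
  finally show ?thesis unfolding U_def .
qed

subsection \<open>Forest weights and the generator\<close>

definition ring_arcs :: "nat \<Rightarrow> (nat \<times> nat) set" where
  "ring_arcs N = (\<lambda>z. (z, ring_next N z)) ` {..<N} \<union> (\<lambda>z. (z, ring_prev N z)) ` {..<N}"

lemma ring_next_less: "0 < N \<Longrightarrow> ring_next N x < N"
  by (simp add: ring_next_def)

lemma ring_prev_less: "0 < N \<Longrightarrow> ring_prev N x < N"
  by (simp add: ring_prev_def)

lemma ring_next_eq: "x < N \<Longrightarrow> ring_next N x = (if Suc x = N then 0 else Suc x)"
  by (auto simp: ring_next_def)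

lemma ring_prev_eq: "x < N \<Longrightarrow> ring_prev N x = (if x = 0 then N - 1 else x - 1)"
  by (auto simp: ring_prev_def mod_if)

lemma finite_ring_arcs: "finite (ring_arcs N)"
  by (simp add: ring_arcs_def)

lemma ring_arcs_subset: "ring_arcs N \<subseteq> {..<N} \<times> {..<N}"
  by (auto simp: ring_arcs_def ring_next_def ring_prev_def)

lemma ring_next_neq_prev:
  assumes "N \<ge> 3" "x < N"
  shows "ring_next N x \<noteq> ring_prev N x"
  using assms by (auto simp: ring_next_eq ring_prev_eq)

text \<open>\<open>N \<ge> 3\<close> keeps the two neighbours distinct, so the sum over a set does
  not merge their terms.\<close>

lemma generator_eq_sum_arcs:
  assumes "N \<ge> 3" "x < N"
  shows "generator N k g x = (\<Sum>u\<in>ring_arcs N `` {x}. k x u * (g u - g x))"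
proof -
  have "ring_arcs N `` {x} = {ring_next N x, ring_prev N x}"
    using assms by (auto simp: ring_arcs_def)
  then show ?thesis
    using ring_next_neq_prev[OF assms] by (simp add: generator_def)
qed

lemma generator_cong:
  assumes "\<And>z. z < N \<Longrightarrow> g z = h z" "x < N"
  shows "generator N k g x = generator N k h x"
  using assms by (simp add: generator_def ring_next_less ring_prev_less)

lemma generator_add_scale:
  "generator N k (\<lambda>z. g z + c * h z) x = generator N k g x + c * generator N k h x"
  by (simp add: generator_def algebra_simps)

lemma generator_eq_sum_indicator:
  assumes "x < N"
  shows "generator N k g x = (\<Sum>y<N. g y * generator N k (indicator {y}) x)"
proof -
  have *: "(\<Sum>y<N. g y * (c * (indicator {y} v - indicator {y} x))) = c * (g v - g x)"
    if "v < N" for v c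
  proof -
    have "(\<Sum>y<N. g y * (c * (indicator {y} v - indicator {y} x))) =
        c * ((\<Sum>y<N. g y * indicator {y} v) - (\<Sum>y<N. g y * indicator {y} x))"
      unfolding sum_subtractf[symmetric] sum_distrib_left by (rule sum.cong) (simp_all add: algebra_simps)
    also have "\<dots> = c * (g v - g x)"
      using that assms by (simp add: indicator_def if_distrib cong: if_cong)
    finally show ?thesis .
  qed
  show ?thesis
    unfolding generator_def distrib_left sum.distrib
    using assms by (simp add: * ring_next_less ring_prev_less)
qed

text \<open>Stationarity is defined by testing on indicator functions; linearity extends it to every
  \<open>g\<close>.\<close>

lemma stationary_generator_zero:
  assumes "stationary_distribution N k \<rho>"
  shows "(\<Sum>x<N. \<rho> x * generator N k g x) = 0"
proof -
  have "(\<Sum>x<N. \<rho> x * generator N k g x) =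
      (\<Sum>x<N. \<Sum>y<N. g y * (\<rho> x * generator N k (indicator {y}) x))"
    by (rule sum.cong[OF refl], subst generator_eq_sum_indicator)
       (auto simp: sum_distrib_left mult_ac)
  also have "\<dots> = (\<Sum>y<N. g y * (\<Sum>x<N. \<rho> x * generator N k (indicator {y}) x))"
    by (subst sum.swap) (simp add: sum_distrib_left)
  finally show ?thesis
    using assms by (simp add: stationary_distribution_def)
qed

definition forest_operator ::
    "nat \<Rightarrow> (nat \<Rightarrow> nat \<Rightarrow> real) \<Rightarrow> nat \<Rightarrow> (nat \<Rightarrow> real) \<Rightarrow> nat \<Rightarrow> real" where
  "forest_operator N k m g x = (\<Sum>y<N. forests_weight_to k (ring_arcs N) m x y * g y)"

text \<open>The coefficient identity is multiplied by \<open>g y\<close> and summed over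
  \<open>y\<close>; its diagonal term leaves \<open>g x\<close>.\<close>

lemma forest_operator_Suc:
  assumes "N \<ge> 3" "x < N"
  shows "forest_operator N k (Suc m) g x =
    generator N k (forest_operator N k m g) x + forests_weight k (ring_arcs N) (Suc m) * g x"
proof -
  let ?W = "forests_weight_to k (ring_arcs N)" and ?s = "forests_weight k (ring_arcs N) (Suc m)"
  have "generator N k (forest_operator N k m g) x =
      (\<Sum>y<N. (\<Sum>u\<in>ring_arcs N `` {x}. k x u * (?W m u y - ?W m x y)) * g y)"
    unfolding generator_eq_sum_arcs[OF assms] forest_operator_def sum_subtractf[symmetric]
      sum_distrib_left sum_distrib_right
    by (subst sum.swap) (simp add: algebra_simps)
  also have "\<dots> = (\<Sum>y<N. ?W (Suc m) x y * g y - of_bool (x = y) * ?s * g y)"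
    by (simp only: forests_weight_to_generator[OF finite_ring_arcs]) (simp add: algebra_simps)
  also have "\<dots> = forest_operator N k (Suc m) g x - ?s * g x"
    using assms(2) by (simp add: forest_operator_def sum_subtractf of_bool_def if_distrib[of "\<lambda>c. c * _"] cong: if_cong)
  finally show ?thesis by simp
qed

text \<open>\<open>W\<^sub>0\<close> is the identity: in the empty forest every vertex is its own
  root.\<close>

lemma forest_operator_0:
  assumes "x < N"
  shows "forest_operator N k 0 g x = g x"
  using assms
  by (simp add: forest_operator_def forests_weight_to_def forests_0 finite_ring_arcs weight_def
      of_bool_def if_distrib[of "\<lambda>c. c * _"] cong: if_cong)

text \<open>The recursion exhibits \<open>forest_operator\<close> as a polynomial in the generator.\<close>

lemma forest_operator_commutes:
  assumes "N \<ge> 3" "x < N"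
  shows "forest_operator N k m (generator N k g) x = generator N k (forest_operator N k m g) x"
  using assms(2)
proof (induction m arbitrary: x)
  case 0
  then show ?case
    using generator_cong[of N "forest_operator N k 0 g" g] by (simp add: forest_operator_0)
next
  case (Suc m)
  let ?L = "generator N k" and ?s = "forests_weight k (ring_arcs N) (Suc m)"
  have "forest_operator N k (Suc m) (?L g) x = ?L (forest_operator N k m (?L g)) x + ?s * ?L g x"
    by (rule forest_operator_Suc[OF assms(1) Suc.prems])
  also have "\<dots> = ?L (?L (forest_operator N k m g)) x + ?s * ?L g x"
    using generator_cong[of N, OF Suc.IH Suc.prems] by simp
  also have "\<dots> = ?L (\<lambda>z. ?L (forest_operator N k m g) z + ?s * g z) x"
    by (simp add: generator_add_scale)
  also have "\<dots> = ?L (forest_operator N k (Suc m) g) x"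
    by (rule generator_cong[OF _ Suc.prems]) (simp add: forest_operator_Suc[OF assms(1)])
  finally show ?case .
qed

subsection \<open>The semigroup\<close>

text \<open>Each application of the generator multiplies a uniform bound by at most
  \<open>2 * K\<close>; sums over the ring serve as crude maxima in \<open>K\<close> and
  \<open>B\<close>.\<close>

lemma generator_power_bound:
  "\<exists>C B. \<forall>n. \<forall>x<N. \<bar>(generator N k ^^ n) g x\<bar> \<le> C ^ n * B"
proof -
  define K where "K = (\<Sum>x<N. \<bar>k x (ring_next N x)\<bar> + \<bar>k x (ring_prev N x)\<bar>)"
  define B where "B = (\<Sum>x<N. \<bar>g x\<bar>)"
  have K: "\<bar>k x (ring_next N x)\<bar> + \<bar>k x (ring_prev N x)\<bar> \<le> K" if "x < N" for x
    unfolding K_def using that by (intro member_le_sum) auto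
  have "\<bar>(generator N k ^^ n) g x\<bar> \<le> (2 * K) ^ n * B" if "x < N" for n x
    using that
  proof (induction n arbitrary: x)
    case 0
    then show ?case by (auto simp: B_def intro!: member_le_sum)
  next
    case (Suc n)
    let ?h = "(generator N k ^^ n) g" and ?M = "(2 * K) ^ n * B"
    have d: "\<bar>?h v - ?h x\<bar> \<le> 2 * ?M" if "v < N" for v
      using Suc.IH[OF that] Suc.IH[OF Suc.prems] by linarith
    have "\<bar>generator N k ?h x\<bar> \<le> \<bar>k x (ring_next N x)\<bar> * \<bar>?h (ring_next N x) - ?h x\<bar> +
        \<bar>k x (ring_prev N x)\<bar> * \<bar>?h (ring_prev N x) - ?h x\<bar>"
      unfolding generator_def abs_mult[symmetric] by (rule abs_triangle_ineq)
    also have "\<dots> \<le> \<bar>k x (ring_next N x)\<bar> * (2 * ?M) + \<bar>k x (ring_prev N x)\<bar> * (2 * ?M)"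
      using Suc.prems by (intro add_mono mult_left_mono d ring_next_less ring_prev_less) auto
    also have "\<dots> = (\<bar>k x (ring_next N x)\<bar> + \<bar>k x (ring_prev N x)\<bar>) * (2 * ?M)"
      by (simp add: algebra_simps)
    also have "\<dots> \<le> K * (2 * ?M)"
      using K[OF Suc.prems] Suc.IH[OF Suc.prems] by (intro mult_right_mono) auto
    finally show ?case by (simp add: mult_ac)
  qed
  then show ?thesis by blast
qed

text \<open>The series is dominated by a multiple of the exponential series at
  \<open>\<bar>t\<bar> * C\<close>.\<close>

lemma summable_semigroup_exp:
  assumes "x < N"
  shows "summable (\<lambda>n. t ^ n / fact n * (generator N k ^^ n) g x)"
proof -
  obtain C B where CB: "\<And>n x. x < N \<Longrightarrow> \<bar>(generator N k ^^ n) g x\<bar> \<le> C ^ n * B"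
    using generator_power_bound[of N k g] by metis
  have "summable (\<lambda>n. (\<bar>t\<bar> * C) ^ n / fact n * B)"
    using summable_exp_generic[of "\<bar>t\<bar> * C"] by (intro summable_mult2) (simp add: scaleR_conv_of_real divide_inverse mult.commute)
  moreover have "norm (t ^ n / fact n * (generator N k ^^ n) g x) \<le> (\<bar>t\<bar> * C) ^ n / fact n * B" for n
    using mult_left_mono[OF CB[OF assms, of n], of "\<bar>t\<bar> ^ n / fact n"]
    by (simp add: abs_mult power_abs power_mult_distrib mult_ac)
  ultimately show ?thesis by (rule summable_comparison_test')
qed

lemma semigroup_exp_0: "semigroup_exp N k 0 g x = g x"
proof -
  have "(\<lambda>n. 0 ^ n / fact n * (generator N k ^^ n) g x) = (\<lambda>n. if n = 0 then g x else 0)"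
    by (auto simp: power_0_left)
  moreover have "(\<Sum>n. if n = 0 then g x else 0) = g x"
    using sums_unique[OF sums_single[of 0 "\<lambda>_. g x"]] by (rule sym)
  ultimately show ?thesis
    by (simp only: semigroup_exp_def)
qed

text \<open>Termwise differentiation shifts the power series by one, which adds one application of
  \<open>L\<close> to each term; \<open>L\<close> combines finitely many values, so it can be pulled
  out of the series.\<close>

lemma semigroup_exp_has_derivative:
  assumes "x < N"
  shows "((\<lambda>t. semigroup_exp N k t g x) has_real_derivative
    generator N k (semigroup_exp N k t g) x) (at t)"
proof -
  let ?a = "\<lambda>x n. t ^ n / fact n * (generator N k ^^ n) g x"
  define c where "c n = (generator N k ^^ n) g x / fact n" for n
  have eq: "semigroup_exp N k t g x = (\<Sum>n. c n * t ^ n)" for t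
    by (simp add: semigroup_exp_def c_def mult.commute)
  have "((\<lambda>t. \<Sum>n. c n * t ^ n) has_real_derivative (\<Sum>n. diffs c n * t ^ n)) (at t)"
  proof (rule termdiffs_strong_converges_everywhere)
    show "summable (\<lambda>n. c n * s ^ n)" for s
      using summable_semigroup_exp[OF assms, of s k g] by (simp add: c_def mult.commute)
  qed
  moreover have "(\<lambda>n. diffs c n * t ^ n) = (\<lambda>n. t ^ n / fact n * generator N k ((generator N k ^^ n) g) x)"
    by (rule ext) (simp add: diffs_def c_def field_simps del: of_nat_Suc)
  moreover have "(\<lambda>n. t ^ n / fact n * generator N k ((generator N k ^^ n) g) x) sums
      generator N k (semigroup_exp N k t g) x"
  proof -
    have s: "?a v sums semigroup_exp N k t g v" if "v < N" for v
      unfolding semigroup_exp_def using summable_semigroup_exp[OF that] by (rule summable_sums)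
    have n: "ring_next N x < N" "ring_prev N x < N"
      using assms by (auto intro: ring_next_less ring_prev_less)
    have "(\<lambda>n. k x (ring_next N x) * (?a (ring_next N x) n - ?a x n) +
        k x (ring_prev N x) * (?a (ring_prev N x) n - ?a x n)) sums generator N k (semigroup_exp N k t g) x"
      unfolding generator_def[of _ _ "semigroup_exp N k t g"]
      by (intro sums_add sums_mult sums_diff s n assms)
    then show ?thesis
      by (simp add: generator_def[of N k "(generator N k ^^ _) g"] algebra_simps)
  qed
  ultimately show ?thesis
    by (simp add: eq sums_iff)
qed

subsection \<open>Exponential decay\<close>

text \<open>A function of mean zero is bounded by its oscillation, which is at most its total
  variation \<open>M\<close> along the path from \<open>0\<close> to \<open>N - 1\<close>;
  Cauchy-Schwarz bounds \<open>M\<^sup>2\<close>.\<close>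

lemma poincare_path:
  assumes \<rho>: "\<And>x. x < N \<Longrightarrow> 0 \<le> \<rho> x" "(\<Sum>x<N. \<rho> x) = 1" and mean: "(\<Sum>x<N. \<rho> x * g x) = 0"
  shows "(\<Sum>x<N. \<rho> x * (g x)\<^sup>2) \<le> real N * (\<Sum>i<N - 1. (g (Suc i) - g i)\<^sup>2)"
proof -
  define M where "M = (\<Sum>i<N - 1. \<bar>g (Suc i) - g i\<bar>)"
  have tele: "\<bar>g b - g a\<bar> \<le> M" if "a \<le> b" "b < N" for a b
  proof -
    have "\<bar>g b - g a\<bar> = \<bar>\<Sum>i=a..<b. g (Suc i) - g i\<bar>"
      using that by (simp add: sum_Suc_diff')
    also have "\<dots> \<le> (\<Sum>i=a..<b. \<bar>g (Suc i) - g i\<bar>)"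
      by (rule sum_abs)
    also have "\<dots> \<le> M"
      unfolding M_def using that by (intro sum_mono2) auto
    finally show ?thesis .
  qed
  have osc: "\<bar>g x - g z\<bar> \<le> M" if "x < N" "z < N" for x z
    using tele[of x z] tele[of z x] that by (cases "x \<le> z") (auto simp: abs_minus_commute)
  have bound: "\<bar>g x\<bar> \<le> M" if x: "x < N" for x
  proof -
    \<comment> \<open>Subtracting the vanishing mean writes \<open>g x\<close> as an average of the
      differences \<open>g x - g z\<close>.\<close>
    have "g x = (\<Sum>z<N. \<rho> z) * g x - (\<Sum>z<N. \<rho> z * g z)"
      using \<rho>(2) mean by simp
    also have "\<dots> = (\<Sum>z<N. \<rho> z * (g x - g z))"
      by (simp add: sum_distrib_right sum_subtractf right_diff_distrib)
    finally have "\<bar>g x\<bar> \<le> (\<Sum>z<N. \<bar>\<rho> z * (g x - g z)\<bar>)"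
      by (metis sum_abs)
    also have "\<dots> \<le> (\<Sum>z<N. \<rho> z * M)"
      using \<rho>(1) osc[OF x] by (intro sum_mono) (simp add: abs_mult mult_left_mono)
    finally show ?thesis by (simp add: sum_distrib_right[symmetric] \<rho>(2))
  qed
  have "M\<^sup>2 \<le> (\<Sum>i<N - 1. (g (Suc i) - g i)\<^sup>2) * real (N - 1)"
    using sum_squared_le_sum_of_squares[of "\<lambda>i. \<bar>g (Suc i) - g i\<bar>" "{..<N - 1}"] by (simp add: M_def)
  also have "\<dots> \<le> (\<Sum>i<N - 1. (g (Suc i) - g i)\<^sup>2) * real N"
    by (intro mult_left_mono sum_nonneg) auto
  finally have M: "M\<^sup>2 \<le> real N * (\<Sum>i<N - 1. (g (Suc i) - g i)\<^sup>2)"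
    by (simp add: mult.commute)
  have "(g x)\<^sup>2 \<le> M\<^sup>2" if "x < N" for x
    using power_mono[OF bound[OF that], of 2] by simp
  then have "(\<Sum>x<N. \<rho> x * (g x)\<^sup>2) \<le> (\<Sum>x<N. \<rho> x * M\<^sup>2)"
    using \<rho>(1) by (intro sum_mono mult_left_mono) auto
  also have "\<dots> = M\<^sup>2"
    by (simp add: sum_distrib_right[symmetric] \<rho>(2))
  finally show ?thesis using M by simp
qed

text \<open>The identity \<open>L(g\<^sup>2) = 2 g L g + \<Gamma>\<close>, with
  \<open>\<Gamma>\<close> the carre du champ, is averaged against \<open>\<rho>\<close>, which
  annihilates the left side. The forward jumps alone bound the average of \<open>\<Gamma>\<close>
  from below.\<close>

lemma dirichlet_form_bound:
  assumes stat: "stationary_distribution N k \<rho>"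
    and a: "\<And>x. x < N \<Longrightarrow> a \<le> \<rho> x * k x (ring_next N x)"
    and prev: "\<And>x. x < N \<Longrightarrow> 0 \<le> k x (ring_prev N x)" and "0 \<le> a"
  shows "2 * (\<Sum>x<N. \<rho> x * (g x * generator N k g x)) \<le> - a * (\<Sum>i<N - 1. (g (Suc i) - g i)\<^sup>2)"
proof -
  let ?\<Gamma> = "\<lambda>x. k x (ring_next N x) * (g (ring_next N x) - g x)\<^sup>2 + k x (ring_prev N x) * (g (ring_prev N x) - g x)\<^sup>2"
  have \<rho>: "0 \<le> \<rho> x" if "x < N" for x
    using stat that by (simp add: stationary_distribution_def)
  have "generator N k (\<lambda>z. (g z)\<^sup>2) x = 2 * (g x * generator N k g x) + ?\<Gamma> x" for x
    by (simp add: generator_def power2_eq_square algebra_simps)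
  then have "0 = (\<Sum>x<N. \<rho> x * (2 * (g x * generator N k g x) + ?\<Gamma> x))"
    using stationary_generator_zero[OF stat, of "\<lambda>z. (g z)\<^sup>2"] by simp
  also have "\<dots> = 2 * (\<Sum>x<N. \<rho> x * (g x * generator N k g x)) + (\<Sum>x<N. \<rho> x * ?\<Gamma> x)"
    by (simp add: distrib_left sum.distrib sum_distrib_left mult_ac)
  finally have eq: "2 * (\<Sum>x<N. \<rho> x * (g x * generator N k g x)) = - (\<Sum>x<N. \<rho> x * ?\<Gamma> x)"
    by simp
  have "a * (\<Sum>i<N - 1. (g (Suc i) - g i)\<^sup>2) = (\<Sum>i<N - 1. a * (g (ring_next N i) - g i)\<^sup>2)"
    unfolding sum_distrib_left by (rule sum.cong) (auto simp: ring_next_eq)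
  \<comment> \<open>The closing edge from \<open>N - 1\<close> to \<open>0\<close> only adds a
    nonnegative term.\<close>
  also have "\<dots> \<le> (\<Sum>i<N. a * (g (ring_next N i) - g i)\<^sup>2)"
    using \<open>0 \<le> a\<close> by (intro sum_mono2) auto
  also have "\<dots> \<le> (\<Sum>x<N. \<rho> x * ?\<Gamma> x)"
  proof (rule sum_mono)
    fix x assume "x \<in> {..<N}"
    then have x: "x < N" by simp
    have "a * (g (ring_next N x) - g x)\<^sup>2 \<le> (\<rho> x * k x (ring_next N x)) * (g (ring_next N x) - g x)\<^sup>2"
      using a[OF x] by (intro mult_right_mono) auto
    moreover have "0 \<le> \<rho> x * (k x (ring_prev N x) * (g (ring_prev N x) - g x)\<^sup>2)"
      using \<rho>[OF x] prev[OF x] by simp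
    ultimately show "a * (g (ring_next N x) - g x)\<^sup>2 \<le> \<rho> x * ?\<Gamma> x"
      by (simp add: distrib_left mult.assoc)
  qed
  finally show ?thesis using eq by simp
qed

text \<open>Gronwall's argument: \<open>exp (c * t) * H t\<close> has nonpositive
  derivative.\<close>

lemma exponential_decay_if_derivative_le:
  fixes H H' :: "real \<Rightarrow> real"
  assumes H: "\<And>t. (H has_real_derivative H' t) (at t)" and le: "\<And>t. H' t \<le> - c * H t" and "0 \<le> t"
  shows "H t \<le> H 0 * exp (- c * t)"
proof -
  have "exp (c * t) * H t \<le> exp (c * 0) * H 0"
  proof (rule DERIV_nonpos_imp_nonincreasing[OF \<open>0 \<le> t\<close>])
    fix s
    have "((\<lambda>t. exp (c * t) * H t) has_real_derivative exp (c * s) * (H' s + c * H s)) (at s)"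
      by (auto intro!: derivative_eq_intros H simp: algebra_simps)
    moreover have "exp (c * s) * (H' s + c * H s) \<le> 0"
      using le[of s] by (intro mult_nonneg_nonpos) auto
    ultimately show "\<exists>y. ((\<lambda>t. exp (c * t) * H t) has_real_derivative y) (at s) \<and> y \<le> 0" by blast
  qed
  then show ?thesis
    by (simp add: exp_minus field_simps)
qed

text \<open>The mean has derivative zero by stationarity, so the Poincare inequality stays
  applicable at every time.\<close>

lemma semigroup_exp_mean:
  assumes stat: "stationary_distribution N k \<rho>"
  shows "(\<Sum>x<N. \<rho> x * semigroup_exp N k t g x) = (\<Sum>x<N. \<rho> x * g x)"
proof -
  have "((\<lambda>t. \<Sum>x<N. \<rho> x * semigroup_exp N k t g x) has_real_derivative
      (\<Sum>x<N. \<rho> x * generator N k (semigroup_exp N k s g) x)) (at s)" for s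
    by (intro DERIV_sum DERIV_cmult semigroup_exp_has_derivative) simp
  then have "((\<lambda>t. \<Sum>x<N. \<rho> x * semigroup_exp N k t g x) has_real_derivative 0) (at s)" for s
    by (simp add: stationary_generator_zero[OF stat])
  then have "(\<Sum>x<N. \<rho> x * semigroup_exp N k t g x) = (\<Sum>x<N. \<rho> x * semigroup_exp N k 0 g x)"
    by (intro DERIV_isconst_all) blast
  then show ?thesis by (simp add: semigroup_exp_0)
qed

text \<open>The squared norm \<open>H\<close> weighted by \<open>\<rho>\<close> satisfies
  \<open>H' \<le> - (a / N) H\<close> by the Dirichlet form bound and the Poincare inequality; the
  smallest weight \<open>b\<close> turns its decay into a pointwise one.\<close>

lemma semigroup_exp_decay:
  assumes "0 < N" and stat: "stationary_distribution N k \<rho>"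
    and pos: "\<And>x. x < N \<Longrightarrow> 0 < \<rho> x" "\<And>x. x < N \<Longrightarrow> 0 < k x (ring_next N x)"
      "\<And>x. x < N \<Longrightarrow> 0 \<le> k x (ring_prev N x)"
    and mean: "(\<Sum>x<N. \<rho> x * g x) = 0"
  obtains c B where "0 < c" "\<And>t x. x < N \<Longrightarrow> 0 \<le> t \<Longrightarrow> \<bar>semigroup_exp N k t g x\<bar> \<le> B * exp (- c * t)"
proof -
  define a where "a = Min ((\<lambda>x. \<rho> x * k x (ring_next N x)) ` {..<N})"
  define b where "b = Min (\<rho> ` {..<N})"
  define H where "H t = (\<Sum>x<N. \<rho> x * (semigroup_exp N k t g x)\<^sup>2)" for t
  define H' where "H' t = 2 * (\<Sum>x<N. \<rho> x * (semigroup_exp N k t g x * generator N k (semigroup_exp N k t g) x))" for t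
  have a: "0 < a" "\<And>x. x < N \<Longrightarrow> a \<le> \<rho> x * k x (ring_next N x)"
    unfolding a_def using \<open>0 < N\<close> pos by (auto simp: lessThan_empty_iff)
  have b: "0 < b" "\<And>x. x < N \<Longrightarrow> b \<le> \<rho> x"
    unfolding b_def using \<open>0 < N\<close> pos by (auto simp: lessThan_empty_iff)
  have H: "(H has_real_derivative H' t) (at t)" for t
    unfolding H_def[abs_def] H'_def
    by (auto intro!: derivative_eq_intros semigroup_exp_has_derivative sum.cong simp: sum_distrib_left)
  have le: "H' t \<le> - (a / real N) * H t" for t
  proof -
    let ?u = "semigroup_exp N k t g"
    have "H t \<le> real N * (\<Sum>i<N - 1. (?u (Suc i) - ?u i)\<^sup>2)"
      unfolding H_def
      using stat by (intro poincare_path) (auto simp: stationary_distribution_def semigroup_exp_mean[OF stat] mean)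
    then have "(a / real N) * H t \<le> (a / real N) * (real N * (\<Sum>i<N - 1. (?u (Suc i) - ?u i)\<^sup>2))"
      using a(1) by (intro mult_left_mono) auto
    also have "\<dots> = a * (\<Sum>i<N - 1. (?u (Suc i) - ?u i)\<^sup>2)"
      using \<open>0 < N\<close> by simp
    finally show ?thesis
      using dirichlet_form_bound[OF stat a(2) pos(3), of ?u] a(1) by (simp add: H'_def)
  qed
  show thesis
  proof (rule that)
    \<comment> \<open>The rate is half that of \<open>H\<close>, since \<open>H\<close> is quadratic
      in the solution.\<close>
    show "0 < a / real N / 2" using a(1) \<open>0 < N\<close> by simp
    fix t :: real and x assume x: "x < N" and t: "0 \<le> t"
    have "b * (semigroup_exp N k t g x)\<^sup>2 \<le> \<rho> x * (semigroup_exp N k t g x)\<^sup>2"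
      using b(2)[OF x] by (intro mult_right_mono) auto
    also have "\<dots> \<le> H t"
      unfolding H_def using x pos(1) by (intro member_le_sum[of x "{..<N}" "\<lambda>x. \<rho> x * (semigroup_exp N k t g x)\<^sup>2"]) (auto simp: less_imp_le)
    also have "\<dots> \<le> H 0 * exp (- (a / real N) * t)"
      by (rule exponential_decay_if_derivative_le[OF H le t])
    finally have "(semigroup_exp N k t g x)\<^sup>2 \<le> H 0 / b * exp (- (a / real N) * t)"
      using b(1) by (simp add: field_simps)
    then have "\<bar>semigroup_exp N k t g x\<bar> \<le> sqrt (H 0 / b * exp (- (a / real N) * t))"
      by (simp add: real_le_rsqrt)
    also have "\<dots> = sqrt (H 0 / b) * exp (- (a / real N / 2) * t)"
    proof -
      have "exp (- (a / real N) * t) = (exp (- (a / real N / 2) * t))\<^sup>2"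
        by (simp add: exp_double[symmetric])
      then show ?thesis unfolding real_sqrt_mult by simp
    qed
    finally show "\<bar>semigroup_exp N k t g x\<bar> \<le> sqrt (H 0 / b) * exp (- (a / real N / 2) * t)" .
  qed
qed

subsection \<open>Integration\<close>

text \<open>The fundamental theorem gives the integral over \<open>{0..n}\<close>; dominated
  convergence, with the exponential as majorant, lets \<open>n\<close> tend to infinity.\<close>

lemma has_integral_exponentially_bounded:
  fixes u F :: "real \<Rightarrow> real"
  assumes F: "\<And>t. (F has_real_derivative u t) (at t)"
    and bound: "\<And>t. 0 \<le> t \<Longrightarrow> \<bar>u t\<bar> \<le> B * exp (- c * t)" and "0 < c"
    and lim: "(F \<longlongrightarrow> 0) at_top"
  shows "(u has_integral (- F 0)) {0..}"
proof -
  have ftc: "(u has_integral (F (real n) - F 0)) {0..real n}" for n :: nat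
    by (rule fundamental_theorem_of_calculus)
       (auto intro: has_field_derivative_at_within[OF F] simp flip: has_real_derivative_iff_has_vector_derivative)
  show ?thesis
  proof (rule has_integral_dominated_convergence)
    show "((\<lambda>t. if t \<in> {0..real n} then u t else 0) has_integral (F (real n) - F 0)) {0..}" for n :: nat
      using ftc[of n] by (subst has_integral_restrict) auto
    show "(\<lambda>t. B * exp (- c * t)) integrable_on {0..}"
      by (intro integrable_on_mult_right integrable_on_exp_minus_to_infinity \<open>0 < c\<close>)
    have "0 \<le> B * exp (- c * t)" if "0 \<le> t" for t
      using bound[OF that] by linarith
    then show "\<forall>t\<in>{0..}. norm (if t \<in> {0..real n} then u t else 0) \<le> B * exp (- c * t)" for n :: nat
      using bound by auto
    show "\<forall>t\<in>{0..}. (\<lambda>n. if t \<in> {0..real n} then u t else 0) \<longlonglongrightarrow> u t"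
    proof
      fix t :: real assume t: "t \<in> {0..}"
      obtain m :: nat where "t \<le> real m" using real_arch_simple by blast
      then have "\<forall>\<^sub>F n in sequentially. (if t \<in> {0..real n} then u t else 0) = u t"
        using t by (intro eventually_sequentiallyI[of m]) auto
      then show "(\<lambda>n. if t \<in> {0..real n} then u t else 0) \<longlonglongrightarrow> u t"
        by (rule tendsto_eventually)
    qed
    have "(\<lambda>n. F (real n)) \<longlonglongrightarrow> 0"
      using lim filterlim_real_sequentially by (rule filterlim_compose)
    then show "(\<lambda>n. F (real n) - F 0) \<longlonglongrightarrow> - F 0"
      by (auto intro!: tendsto_eq_intros)
  qed
qed

subsection \<open>Trees in the ring\<close>

lemma ring_prev_next: "x < N \<Longrightarrow> ring_prev N (ring_next N x) = x"
  by (auto simp: ring_next_eq ring_prev_eq)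

lemma ring_next_prev: "x < N \<Longrightarrow> ring_next N (ring_prev N x) = x"
  by (auto simp: ring_prev_eq) (auto simp: ring_next_eq)

lemma ring_edges_iff_arc: "{z, u} \<in> ring_edges N \<longleftrightarrow> (z, u) \<in> ring_arcs N"
proof
  assume "{z, u} \<in> ring_edges N"
  then obtain w where "w < N" "{z, u} = {w, ring_next N w}"
    by (auto simp: ring_edges_def)
  then show "(z, u) \<in> ring_arcs N"
    using ring_prev_next[of w N] ring_next_less[of N w]
    by (auto simp: ring_arcs_def doubleton_eq_iff image_iff)
next
  assume "(z, u) \<in> ring_arcs N"
  then have z: "z < N" and "u = ring_next N z \<or> u = ring_prev N z"
    by (auto simp: ring_arcs_def)
  then show "{z, u} \<in> ring_edges N"
  proof (elim disjE)
    assume "u = ring_prev N z"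
    then have "{z, u} = {u, ring_next N u}" "u < N"
      using z ring_next_prev[OF z] by (auto simp: ring_prev_less insert_commute)
    then show ?thesis unfolding ring_edges_def by blast
  qed (auto simp: ring_edges_def)
qed

text \<open>For \<open>N = 2\<close> the edges leaving \<open>0\<close> and \<open>1\<close> would
  coincide.\<close>

lemma inj_on_ring_edge:
  assumes "N \<ge> 3"
  shows "inj_on (\<lambda>x. {x, ring_next N x}) {..<N}"
  using assms by (auto simp: inj_on_def doubleton_eq_iff ring_next_eq split: if_splits)

lemma ring_edges_eq_image: "ring_edges N = (\<lambda>x. {x, ring_next N x}) ` {..<N}"
  by (auto simp: ring_edges_def)

lemma finite_ring_edges: "finite (ring_edges N)"
  by (simp add: ring_edges_eq_image)

lemma card_ring_edges:
  assumes "N \<ge> 3"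
  shows "card (ring_edges N) = N"
  using card_image[OF inj_on_ring_edge[OF assms]] by (simp add: ring_edges_eq_image)

lemma card_ring_tree:
  assumes "N \<ge> 3" "ring_tree N E"
  shows "card E = N - 1"
  using assms card_ring_edges[OF assms(1)] by (auto simp: ring_tree_def)

lemma card_ring_double_tree:
  assumes "N \<ge> 3" "ring_double_tree N E"
  shows "card E = N - 2"
proof -
  obtain e e' where e: "e \<in> ring_edges N" "e' \<in> ring_edges N" "e \<noteq> e'" "E = ring_edges N - {e, e'}"
    using assms(2) by (auto simp: ring_double_tree_def)
  then show ?thesis
    using card_Diff_subset[of "{e, e'}" "ring_edges N"] card_ring_edges[OF assms(1)] by simp
qed

lemma ring_treeI:
  assumes "N \<ge> 3" "E \<subseteq> ring_edges N" "card E = N - 1"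
  shows "ring_tree N E"
proof -
  have "card (ring_edges N - E) = 1"
    using assms card_Diff_subset[of E "ring_edges N"] finite_subset[OF assms(2) finite_ring_edges]
    by (simp add: card_ring_edges)
  then obtain e where "ring_edges N - E = {e}"
    by (auto simp: card_1_singleton_iff)
  then have "e \<in> ring_edges N" "E = ring_edges N - {e}" using assms(2) by blast+
  then show ?thesis unfolding ring_tree_def by blast
qed

lemma ring_double_treeI:
  assumes "N \<ge> 3" "E \<subseteq> ring_edges N" "card E = N - 2"
  shows "ring_double_tree N E"
proof -
  have "card (ring_edges N - E) = 2"
    using assms card_Diff_subset[of E "ring_edges N"] finite_subset[OF assms(2) finite_ring_edges]
    by (simp add: card_ring_edges)
  then obtain e e' where e: "e \<noteq> e'" "ring_edges N - E = {e, e'}"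
    by (auto simp: card_2_iff)
  then have "e \<in> ring_edges N" "e' \<in> ring_edges N" "E = ring_edges N - {e, e'}"
    using assms(2) by blast+
  then show ?thesis using e(1) unfolding ring_double_tree_def by blast
qed

lemma orientation_subset_ring_arcs:
  assumes "orientation D E" "E \<subseteq> ring_edges N"
  shows "D \<subseteq> ring_arcs N"
proof
  fix p assume p: "p \<in> D"
  obtain z u where "p = (z, u)" by fastforce
  moreover have "undirected p \<in> ring_edges N"
    using assms p unfolding orientation_def bij_betw_def by blast
  ultimately show "p \<in> ring_arcs N"
    by (simp add: undirected_def ring_edges_iff_arc)
qed

lemma orientation_card: "orientation D E \<Longrightarrow> card D = card E"
  unfolding orientation_def by (rule bij_betw_same_card)

text \<open>Acyclicity excludes opposite arcs, so forgetting directions is injective on a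
  forest.\<close>

lemma forest_orientation:
  assumes "D \<in> forests (ring_arcs N) m"
  shows "orientation D (undirected ` D)" "undirected ` D \<subseteq> ring_edges N" "card (undirected ` D) = m"
proof -
  have D: "D \<subseteq> ring_arcs N" "acyclic D" "card D = m"
    using assms by (auto simp: forests_def)
  have "(b, a) \<notin> D" if "(a, b) \<in> D" for a b
    using D(2) that unfolding acyclic_def by (meson trancl.intros)
  then have "inj_on undirected D"
    by (auto simp: inj_on_def undirected_def doubleton_eq_iff)
  then show o: "orientation D (undirected ` D)"
    by (simp add: orientation_def bij_betw_def)
  show "undirected ` D \<subseteq> ring_edges N"
    using D(1) by (auto simp: undirected_def ring_edges_iff_arc)
  show "card (undirected ` D) = m"
    using orientation_card[OF o] D(3) by simp
qed

section \<open>Parts of a subgraph and roots of a forest\<close>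

lemma same_part_sym: "same_part E x y \<Longrightarrow> same_part E y x"
proof -
  have "sym {(u, v). {u, v} \<in> E}" by (auto simp: sym_def insert_commute)
  then show "same_part E x y \<Longrightarrow> same_part E y x"
    unfolding same_part_def by (meson symE sym_rtrancl)
qed

lemma same_part_trans: "same_part E x y \<Longrightarrow> same_part E y z \<Longrightarrow> same_part E x z"
  unfolding same_part_def by (rule rtrancl_trans)

text \<open>An undirected path to a root can be made directed: if it runs from \<open>u\<close> to
  \<open>v\<close> against the arc \<open>(v, u)\<close>, then the unique directed path from
  \<open>v\<close> to \<open>r\<close> starts with that arc, so \<open>u\<close> reaches
  \<open>r\<close> as well.\<close>

lemma same_part_terminal_iff:
  assumes sv: "single_valued D" and r: "r \<notin> Domain D"
  shows "same_part (undirected ` D) z r \<longleftrightarrow> (z, r) \<in> D\<^sup>*"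
proof
  assume "same_part (undirected ` D) z r"
  then show "(z, r) \<in> D\<^sup>*"
    unfolding same_part_def
  proof (induction rule: converse_rtrancl_induct)
    case (step u v)
    then have "(u, v) \<in> D \<or> (v, u) \<in> D"
      by (auto simp: undirected_def doubleton_eq_iff)
    then show ?case
      using step.IH single_valued_step_towards_terminal[OF sv _ _ r]
      by (auto intro: converse_rtrancl_into_rtrancl)
  qed simp
next
  have "D \<subseteq> {(u, v). {u, v} \<in> undirected ` D}"
    by (force simp: undirected_def)
  then show "(z, r) \<in> D\<^sup>* \<Longrightarrow> same_part (undirected ` D) z r"
    unfolding same_part_def using rtrancl_mono by blast
qed

lemma forest_reaches_root:
  assumes D: "D \<in> forests (ring_arcs N) m" and z: "z < N"
  shows "\<exists>r \<in> {..<N} - Domain D. (z, r) \<in> D\<^sup>*"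
proof -
  have sub: "D \<subseteq> ring_arcs N" "acyclic D" using D by (auto simp: forests_def)
  obtain r where r: "(z, r) \<in> D\<^sup>*" "r \<notin> Domain D"
    using acyclic_reaches_terminal[OF finite_subset[OF sub(1) finite_ring_arcs] sub(2)] by blast
  have "r < N"
    using r(1) z sub(1) ring_arcs_subset by (cases rule: rtranclE) auto
  then show ?thesis using r by blast
qed

lemma card_forest_roots:
  assumes "D \<in> forests (ring_arcs N) m"
  shows "card ({..<N} - Domain D) = N - m"
proof -
  have D: "D \<subseteq> ring_arcs N" "single_valued D" "card D = m"
    using assms by (auto simp: forests_def)
  then have "Domain D \<subseteq> {..<N}" using ring_arcs_subset by blast
  then show ?thesis
    using card_Domain_single_valued[OF D(2)] D(3)
    by (subst card_Diff_subset) (auto intro: finite_subset)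
qed

text \<open>Every vertex outside \<open>R\<close> has an outgoing arc. The bound on the
  cardinalities leaves no arc to spare, so each of these vertices has exactly one and those in
  \<open>R\<close> have none.\<close>

lemma forest_if_reaches_roots:
  assumes D: "D \<subseteq> ring_arcs N" and R: "R \<subseteq> {..<N}" and card: "card D + card R \<le> N"
    and reach: "\<And>z. z < N \<Longrightarrow> \<exists>r\<in>R. (z, r) \<in> D\<^sup>*"
  shows "D \<in> forests (ring_arcs N) (card D)" "R = {..<N} - Domain D"
proof -
  have fin: "finite D" "finite (Domain D)" "finite R"
    using finite_subset[OF D finite_ring_arcs] R by (auto intro: finite_subset simp: finite_Domain)
  have dom: "Domain D \<subseteq> {..<N}" using D ring_arcs_subset by blast
  have "{..<N} \<subseteq> Domain D \<union> R"
    using reach by (force elim: converse_rtranclE)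
  then have un: "Domain D \<union> R = {..<N}" using dom R by blast
  have le: "card (Domain D) \<le> card D"
    unfolding Domain_fst by (rule card_image_le[OF fin(1)])
  \<comment> \<open>Inclusion-exclusion turns the counting bound into equality everywhere.\<close>
  have "card (Domain D) + card R = N + card (Domain D \<inter> R)"
    using card_Un_Int[OF fin(2,3)] un by simp
  then have "card (Domain D \<inter> R) = 0" and eq: "card (Domain D) = card D"
    using card le by linarith+
  then have disj: "Domain D \<inter> R = {}" using fin(2) by simp
  have "inj_on fst D"
    using eq fin(1) by (intro eq_card_imp_inj_on) (simp_all add: Domain_fst)
  then have sv: "single_valued D"
    by (fastforce simp: inj_on_def single_valued_def)
  moreover have "acyclic D"
    using sv reach disj dom by (intro acyclic_if_reaches_terminal) blast+
  ultimately show "D \<in> forests (ring_arcs N) (card D)"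
    using D by (simp add: forests_def)
  show "R = {..<N} - Domain D"
    using un disj by blast
qed

text \<open>Removing one edge leaves \<open>N - 1\<close> arcs for a single root, just the count at
  which reachability of the root forces a forest.\<close>

lemma rooted_trees_iff:
  assumes "N \<ge> 3"
  shows "(D, r) \<in> rooted_trees N \<longleftrightarrow> D \<in> forests (ring_arcs N) (N - 1) \<and> {..<N} - Domain D = {r}"
proof
  assume "(D, r) \<in> rooted_trees N"
  then obtain E where r: "r < N" and E: "ring_tree N E" "orientation D E"
    and reach: "\<And>z. z < N \<Longrightarrow> (z, r) \<in> D\<^sup>*"
    by (auto simp: rooted_trees_def)
  have "D \<subseteq> ring_arcs N"
    using E by (intro orientation_subset_ring_arcs) (auto simp: ring_tree_def)
  moreover have "card D = N - 1"
    using orientation_card[OF E(2)] card_ring_tree[OF assms E(1)] by simp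
  ultimately show "D \<in> forests (ring_arcs N) (N - 1) \<and> {..<N} - Domain D = {r}"
    using forest_if_reaches_roots[of D N "{r}"] r reach assms by auto
next
  assume *: "D \<in> forests (ring_arcs N) (N - 1) \<and> {..<N} - Domain D = {r}"
  then have "ring_tree N (undirected ` D)"
    using forest_orientation[of D N "N - 1"] assms by (intro ring_treeI) auto
  moreover have "(z, r) \<in> D\<^sup>*" if "z < N" for z
    using forest_reaches_root[of D N "N - 1" z] * that by auto
  ultimately show "(D, r) \<in> rooted_trees N"
    using * forest_orientation(1)[of D N "N - 1"] by (auto simp: rooted_trees_def)
qed

text \<open>The removed edges are those leaving \<open>a\<close> and \<open>b\<close> forwards, so a
  forward walk from \<open>z\<close> meets \<open>a\<close> or \<open>b\<close> before it could
  cross one.\<close>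

lemma same_part_removed_edge:
  assumes N: "N \<ge> 3" and ab: "a < N" "b < N"
    and E: "E = ring_edges N - {{a, ring_next N a}, {b, ring_next N b}}" and z: "z < N"
  shows "same_part E z a \<or> same_part E z b"
proof -
  have "same_part E z a \<or> same_part E z b" if "(z + j) mod N = a" "z < N" for j z
    using that
  proof (induction j arbitrary: z)
    case 0
    then show ?case by (simp add: same_part_def)
  next
    case (Suc j)
    show ?case
    proof (cases "z = a \<or> z = b")
      case True
      then show ?thesis by (auto simp: same_part_def)
    next
      case False
      then have "{z, ring_next N z} \<in> E"
        using Suc.prems(2) inj_on_ring_edge[OF N] ab
        unfolding E ring_edges_eq_image inj_on_def by blast
      then have "same_part E z (ring_next N z)"
        unfolding same_part_def by auto
      moreover have "(ring_next N z + j) mod N = a"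
        using Suc.prems(1) by (simp add: ring_next_def mod_add_left_eq)
      then have "same_part E (ring_next N z) a \<or> same_part E (ring_next N z) b"
        using Suc.IH N by (simp add: ring_next_less)
      ultimately show ?thesis using same_part_trans by blast
    qed
  qed
  \<comment> \<open>Adding \<open>N\<close> keeps the number of forward steps from \<open>z\<close>
    to \<open>a\<close> a natural number.\<close>
  from this[of z "a + N - z"] show ?thesis
    using z ab by simp
qed

text \<open>Each part contains \<open>a\<close> or \<open>b\<close>; sending a root to such a vertex
  of its part is injective, because a part has only one root.\<close>

lemma card_double_tree_roots:
  assumes N: "N \<ge> 3" and E: "ring_double_tree N E" and R: "R \<subseteq> {..<N}"
    and unique: "\<And>z. z < N \<Longrightarrow> \<exists>!r. r \<in> R \<and> same_part E z r"
  shows "card R \<le> 2"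
proof -
  obtain a b where ab: "a < N" "b < N" and E: "E = ring_edges N - {{a, ring_next N a}, {b, ring_next N b}}"
    using E by (auto simp: ring_double_tree_def ring_edges_def)
  have "inj_on (\<lambda>r. if same_part E r a then a else b) R"
  proof (rule inj_onI)
    fix r s assume rs: "r \<in> R" "s \<in> R"
      and eq: "(if same_part E r a then a else b) = (if same_part E s a then a else b)"
    have "r < N" "s < N" using rs R by auto
    then obtain c where "c < N" "same_part E r c" "same_part E s c"
      using eq same_part_removed_edge[OF N ab E] ab by (metis (full_types))
    then show "r = s"
      using unique[of c] rs same_part_sym by blast
  qed
  then have "card R \<le> card {a, b}"
    by (rule card_inj_on_le) auto
  also have "\<dots> \<le> 2" by (simp add: card_insert_if)
  finally show ?thesis .
qed

text \<open>From left to right this is the counting argument with two roots. Conversely, the part of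
  a root is the set of vertices that flow into it, so the unique root of a part is the unique
  terminal point.\<close>

lemma double_rooted_trees_iff:
  assumes "N \<ge> 3"
  shows "(D, R) \<in> double_rooted_trees N \<longleftrightarrow>
    D \<in> forests (ring_arcs N) (N - 2) \<and> R = {..<N} - Domain D"
proof
  assume "(D, R) \<in> double_rooted_trees N"
  then obtain E where R: "R \<subseteq> {..<N}" and E: "ring_double_tree N E" "orientation D E"
    and unique: "\<And>z. z < N \<Longrightarrow> \<exists>!r. r \<in> R \<and> same_part E z r"
    and reach: "\<And>z r. z < N \<Longrightarrow> r \<in> R \<Longrightarrow> same_part E z r \<Longrightarrow> (z, r) \<in> D\<^sup>*"
    by (auto simp: double_rooted_trees_def)
  have "D \<subseteq> ring_arcs N"
    using E by (intro orientation_subset_ring_arcs) (auto simp: ring_double_tree_def)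
  moreover have card: "card D = N - 2"
    using orientation_card[OF E(2)] card_ring_double_tree[OF assms E(1)] by simp
  moreover have "card R \<le> 2"
    by (rule card_double_tree_roots[OF assms E(1) R unique])
  moreover have "\<exists>r\<in>R. (z, r) \<in> D\<^sup>*" if "z < N" for z
    using unique[OF that] reach[OF that] by blast
  ultimately show "D \<in> forests (ring_arcs N) (N - 2) \<and> R = {..<N} - Domain D"
    using forest_if_reaches_roots[of D N R] R assms by auto
next
  assume *: "D \<in> forests (ring_arcs N) (N - 2) \<and> R = {..<N} - Domain D"
  then have D: "D \<in> forests (ring_arcs N) (N - 2)" and sv: "single_valued D"
    by (auto simp: forests_def)
  have "ring_double_tree N (undirected ` D)"
    using forest_orientation[OF D] assms by (intro ring_double_treeI) auto
  moreover have same: "same_part (undirected ` D) z r \<longleftrightarrow> (z, r) \<in> D\<^sup>*" if "r \<in> R" for z r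
    using same_part_terminal_iff[OF sv] that * by blast
  moreover have "\<exists>!r. r \<in> R \<and> same_part (undirected ` D) z r" if "z < N" for z
  proof -
    have "\<exists>r\<in>R. (z, r) \<in> D\<^sup>*"
      using forest_reaches_root[OF D that] * by simp
    moreover have "r = s" if "r \<in> R" "s \<in> R" "(z, r) \<in> D\<^sup>*" "(z, s) \<in> D\<^sup>*" for r s
      using single_valued_rtrancl_terminal_unique[OF sv that(3,4)] that(1,2) * by blast
    ultimately show ?thesis using same by metis
  qed
  moreover have "R \<subseteq> {..<N}" using * by blast
  ultimately show "(D, R) \<in> double_rooted_trees N"
    using forest_orientation(1)[OF D] unfolding double_rooted_trees_def by blast
qed

section \<open>Tree weights as forest weights\<close>

lemma total_weight_eq_sum_if_bij:
  assumes "bij_betw fst S F"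
  shows "total_weight k S = (\<Sum>D\<in>F. weight k D)"
  using sum.reindex_bij_betw[OF assms, of "weight k"]
  by (simp add: total_weight_def case_prod_unfold)

text \<open>The root is determined by the arcs as the only vertex without one, so forgetting it is a
  bijection onto forests.\<close>

lemma total_weight_rooted_trees:
  assumes "N \<ge> 3"
  shows "total_weight k (rooted_trees N) = forests_weight k (ring_arcs N) (N - 1)"
  unfolding forests_weight_def
proof (rule total_weight_eq_sum_if_bij, rule bij_betw_imageI)
  show "inj_on fst (rooted_trees N)"
    using rooted_trees_iff[OF assms] by (auto simp: inj_on_def)
  show "fst ` rooted_trees N = forests (ring_arcs N) (N - 1)"
  proof (intro equalityI subsetI)
    fix D assume D: "D \<in> forests (ring_arcs N) (N - 1)"
    then have "card ({..<N} - Domain D) = 1"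
      using card_forest_roots[OF D] assms by simp
    then obtain r where "{..<N} - Domain D = {r}"
      by (auto simp: card_1_singleton_iff)
    then have "(D, r) \<in> rooted_trees N"
      using D rooted_trees_iff[OF assms] by simp
    then show "D \<in> fst ` rooted_trees N" by force
  qed (use rooted_trees_iff[OF assms] in auto)
qed

text \<open>The arcs determine the set of roots, and \<open>x\<close> lies in the part of the root
  \<open>y\<close> exactly when the arcs lead from \<open>x\<close> to \<open>y\<close>.\<close>

lemma total_weight_double_rooted_trees_to:
  assumes "N \<ge> 3" "y < N"
  shows "total_weight k (double_rooted_trees_to N x y) = forests_weight_to k (ring_arcs N) (N - 2) x y"
proof -
  let ?F = "{D \<in> forests (ring_arcs N) (N - 2). (x, y) \<in> D\<^sup>* \<and> y \<notin> Domain D}"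
  have iff: "(D, R) \<in> double_rooted_trees_to N x y \<longleftrightarrow> D \<in> ?F \<and> R = {..<N} - Domain D" for D R
    using assms same_part_terminal_iff[of D y x]
    unfolding double_rooted_trees_to_def double_rooted_trees_iff[OF assms(1), symmetric]
    by (auto simp: double_rooted_trees_iff forests_def)
  have "double_rooted_trees_to N x y = (\<lambda>D. (D, {..<N} - Domain D)) ` ?F"
  proof (rule set_eqI)
    fix p :: "(nat \<times> nat) set \<times> nat set"
    show "p \<in> double_rooted_trees_to N x y \<longleftrightarrow> p \<in> (\<lambda>D. (D, {..<N} - Domain D)) ` ?F"
      using iff[of "fst p" "snd p"] by (cases p) (simp add: image_iff)
  qed
  then have "bij_betw fst (double_rooted_trees_to N x y) ?F"
    by (simp add: bij_betw_def inj_on_def image_image)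
  then have "total_weight k (double_rooted_trees_to N x y) = (\<Sum>D\<in>?F. weight k D)"
    by (rule total_weight_eq_sum_if_bij)
  also have "\<dots> = forests_weight_to k (ring_arcs N) (N - 2) x y"
    unfolding forests_weight_to_def
    using finite_forests[OF finite_ring_arcs]
    by (intro sum.mono_neutral_cong_left) (auto simp: of_bool_def)
  finally show ?thesis .
qed

text \<open>With \<open>N - 1\<close> arcs there is a single root, and it is reached from every
  vertex.\<close>

lemma spanning_tree_weight_to_indep:
  assumes "x < N" "x' < N"
  shows "forests_weight_to k (ring_arcs N) (N - 1) x y = forests_weight_to k (ring_arcs N) (N - 1) x' y"
  unfolding forests_weight_to_def
proof (rule sum.cong[OF refl])
  fix D assume D: "D \<in> forests (ring_arcs N) (N - 1)"
  then have sv: "single_valued D" by (simp add: forests_def)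
  have "card ({..<N} - Domain D) = 1"
    using card_forest_roots[OF D] assms by simp
  then obtain r where r: "{..<N} - Domain D = {r}"
    by (auto simp: card_1_singleton_iff)
  have "(z, y) \<in> D\<^sup>* \<and> y \<notin> Domain D \<longleftrightarrow> y = r" if "z < N" for z
  proof -
    have "(z, r) \<in> D\<^sup>*" "r \<notin> Domain D"
      using forest_reaches_root[OF D that] r by auto
    then show ?thesis
      using single_valued_rtrancl_terminal_unique[OF sv] by metis
  qed
  then show "weight k D * of_bool ((x, y) \<in> D\<^sup>* \<and> y \<notin> Domain D) =
      weight k D * of_bool ((x', y) \<in> D\<^sup>* \<and> y \<notin> Domain D)"
    using assms by simp
qed

lemma spanning_tree_weight_to_pos:
  assumes "N \<ge> 3" and y: "y < N"
    and pos: "\<And>z u. (z, u) \<in> ring_arcs N \<Longrightarrow> 0 < k z u"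
  shows "0 < forests_weight_to k (ring_arcs N) (N - 1) y y"
proof -
  \<comment> \<open>The witness is the path from \<open>0\<close> to \<open>N - 1\<close> with every
    arc pointing towards \<open>y\<close>.\<close>
  define D where "D = (\<lambda>z. (z, if z < y then Suc z else z - 1)) ` ({..<N} - {y})"
  have "D \<subseteq> ring_arcs N"
    using y by (auto simp: D_def ring_arcs_def ring_next_eq ring_prev_eq image_iff)
  moreover have "single_valued D"
    by (auto simp: D_def single_valued_def)
  moreover have "acyclic D"
  proof -
    \<comment> \<open>With truncated subtraction the measure is the distance to \<open>y\<close>,
      which drops along each arc.\<close>
    have "D \<subseteq> (Wellfounded.measure (\<lambda>z. (z - y) + (y - z)))\<inverse>"
      by (auto simp: D_def split: if_splits)
    moreover have "acyclic ((Wellfounded.measure (\<lambda>z. (z - y) + (y - z)))\<inverse>)"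
      by (simp add: wf_acyclic)
    ultimately show ?thesis by (rule acyclic_subset[rotated])
  qed
  moreover have "card D = N - 1"
    using y by (subst D_def, subst card_image) (auto simp: inj_on_def)
  ultimately have D: "D \<in> forests (ring_arcs N) (N - 1)"
    by (simp add: forests_def)
  have w: "0 < weight k D" if "D \<subseteq> ring_arcs N" for D
    unfolding weight_def using that pos by (intro prod_pos) auto
  show ?thesis
    unfolding forests_weight_to_def
  proof (rule sum_pos2[OF finite_forests[OF finite_ring_arcs] D])
    show "0 < weight k D * of_bool ((y, y) \<in> D\<^sup>* \<and> y \<notin> Domain D)"
      using w[OF \<open>D \<subseteq> ring_arcs N\<close>] by (simp add: D_def Domain_fst image_image)
    show "0 \<le> weight k D * of_bool ((y, y) \<in> D\<^sup>* \<and> y \<notin> Domain D)"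
      if "D \<in> forests (ring_arcs N) (N - 1)" for D
      using w[of D] that by (simp add: forests_def)
  qed
qed

subsection \<open>The quasipotential\<close>

text \<open>This is the Markov chain tree theorem. Multiplying \<open>W\<^sub>N\<^sub>-\<^sub>1 = L
  W\<^sub>N\<^sub>-\<^sub>2 + \<sigma>\<^sub>N\<^sub>-\<^sub>1\<close> by \<open>\<rho>\<close> from
  the left removes the term with \<open>L\<close>, and averaging equal rows returns that
  row.\<close>

lemma stationary_eq_tree_weight:
  assumes "N \<ge> 3" "stationary_distribution N k \<rho>" "y < N"
  shows "\<rho> y * forests_weight k (ring_arcs N) (N - 1) = forests_weight_to k (ring_arcs N) (N - 1) y y"
proof -
  let ?A = "ring_arcs N" and ?g = "indicator {y} :: nat \<Rightarrow> real"
  have N: "N - 1 = Suc (N - 2)" using assms(1) by simp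
  have "forest_operator N k (N - 1) ?g x = forests_weight_to k ?A (N - 1) y y" if "x < N" for x
    using assms(3) spanning_tree_weight_to_indep[OF that assms(3), of k y]
    by (simp add: forest_operator_def indicator_def if_distrib cong: if_cong)
  then have "(\<Sum>x<N. \<rho> x) * forests_weight_to k ?A (N - 1) y y =
      (\<Sum>x<N. \<rho> x * forest_operator N k (N - 1) ?g x)"
    by (simp add: sum_distrib_right)
  also have "\<dots> = (\<Sum>x<N. \<rho> x * generator N k (forest_operator N k (N - 2) ?g) x) +
      (\<Sum>x<N. \<rho> x * (forests_weight k ?A (N - 1) * ?g x))"
    unfolding N sum.distrib[symmetric] distrib_left[symmetric]
    by (intro sum.cong refl) (simp add: forest_operator_Suc[OF assms(1)])
  also have "\<dots> = \<rho> y * forests_weight k ?A (N - 1)"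
    using assms(3) by (simp add: stationary_generator_zero[OF assms(2)] indicator_def of_bool_def
        if_distrib[of "\<lambda>c. _ * c"] cong: if_cong)
  finally show ?thesis
    using assms(2) by (simp add: stationary_distribution_def)
qed

lemma forest_operator_spanning_trees:
  assumes "N \<ge> 3" "stationary_distribution N k \<rho>" "x < N"
  shows "forest_operator N k (N - 1) g x = forests_weight k (ring_arcs N) (N - 1) * (\<Sum>y<N. \<rho> y * g y)"
  unfolding forest_operator_def sum_distrib_left
proof (rule sum.cong[OF refl])
  fix y assume "y \<in> {..<N}"
  then have y: "y < N" by simp
  show "forests_weight_to k (ring_arcs N) (N - 1) x y * g y =
      forests_weight k (ring_arcs N) (N - 1) * (\<rho> y * g y)"
    unfolding spanning_tree_weight_to_indep[OF assms(3) y]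
      stationary_eq_tree_weight[OF assms(1,2) y, symmetric] by (simp add: mult_ac)
qed

theorem mainTheorem2:
  fixes N :: nat and k :: "nat \<Rightarrow> nat \<Rightarrow> real" and \<rho> f :: "nat \<Rightarrow> real" and x :: nat
  assumes "N \<ge> 3"
    and "\<And>z. z < N \<Longrightarrow> k z (ring_next N z) > 0"
    and "\<And>z. z < N \<Longrightarrow> k z (ring_prev N z) > 0"
    and "\<And>z u. z < N \<Longrightarrow> u < N \<Longrightarrow> u \<noteq> ring_next N z \<Longrightarrow> u \<noteq> ring_prev N z \<Longrightarrow> k z u = 0"
    and "stationary_distribution N k \<rho>"
    and "(\<Sum>y<N. \<rho> y * f y) = 0"
    and "x < N"
  shows "(\<lambda>t. semigroup_exp N k t f x) integrable_on {0..} \<and>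
         quasipotential N k f x =
           (\<Sum>y<N. total_weight k (double_rooted_trees_to N x y) * f y)
             / total_weight k (rooted_trees N)"
proof -
  note N = assms(1) and stat = assms(5)
  define s where "s = forests_weight k (ring_arcs N) (N - 1)"
  define u where "u t = semigroup_exp N k t f" for t
  \<comment> \<open>This antiderivative of \<open>u t x\<close> vanishes at infinity, so the
    integral is \<open>- F 0\<close>.\<close>
  define F where "F t = - forest_operator N k (N - 2) (u t) x / s" for t
  have N_minus_1: "N - 1 = Suc (N - 2)" using N by simp
  \<comment> \<open>Positive rates make the tree weight \<open>\<rho> y * s\<close> positive; since
    \<open>\<rho> y \<ge> 0\<close>, both factors are positive.\<close>
  have "0 < k z v" if "(z, v) \<in> ring_arcs N" for z v
    using that assms(2,3) by (auto simp: ring_arcs_def)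
  then have "0 < \<rho> y * s" if "y < N" for y
    using spanning_tree_weight_to_pos[OF N that] stationary_eq_tree_weight[OF N stat that]
    by (simp add: s_def)
  moreover have "0 \<le> \<rho> y" if "y < N" for y
    using stat that by (simp add: stationary_distribution_def)
  ultimately have \<rho>: "0 < \<rho> y" and "0 < s" if "y < N" for y
    using that by (force simp: zero_less_mult_iff)+
  then have s: "0 < s" using assms(7) by blast
  have mean: "(\<Sum>y<N. \<rho> y * u t y) = 0" for t
    by (simp add: u_def semigroup_exp_mean[OF stat] assms(6))
  obtain c B where "0 < c" and bound: "\<And>t y. y < N \<Longrightarrow> 0 \<le> t \<Longrightarrow> \<bar>u t y\<bar> \<le> B * exp (- c * t)"
    unfolding u_def
    by (rule semigroup_exp_decay[of N k \<rho> f]) (use N stat \<rho> assms(2,3,6) in \<open>auto simp: less_imp_le\<close>)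
  have deriv: "((\<lambda>t. u t y) has_real_derivative generator N k (u t) y) (at t)" if "y < N" for t y
    unfolding u_def by (rule semigroup_exp_has_derivative[OF that])
  \<comment> \<open>The recursion is read backwards: \<open>W\<^sub>N\<^sub>-\<^sub>1\<close> maps
    \<open>u t\<close> to \<open>s\<close> times its mean, which is zero.\<close>
  have gen: "generator N k (forest_operator N k (N - 2) (u t)) x = - s * u t x" for t
    using forest_operator_Suc[OF N assms(7), of k "N - 2" "u t"]
      forest_operator_spanning_trees[OF N stat assms(7), of "u t"]
    unfolding s_def N_minus_1 mean by simp
  have F': "(F has_real_derivative u t x) (at t)" for t
  proof -
    \<comment> \<open>Differentiation puts \<open>L\<close> inside
      \<open>W\<^sub>N\<^sub>-\<^sub>2\<close>; commuting the two makes \<open>gen\<close>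
      applicable.\<close>
    have "(F has_real_derivative - forest_operator N k (N - 2) (generator N k (u t)) x / s) (at t)"
      unfolding F_def[abs_def] forest_operator_def
      by (intro DERIV_cdivide DERIV_minus DERIV_sum DERIV_cmult deriv) simp
    then show ?thesis
      using s gen[of t]
      by (simp add: forest_operator_commutes[OF N assms(7)])
  qed
  have "((\<lambda>t. u t y) \<longlongrightarrow> 0) at_top" if "y < N" for y
  proof (rule Lim_null_comparison)
    show "\<forall>\<^sub>F t in at_top. norm (u t y) \<le> B * exp (- c * t)"
      using bound[OF that] by (intro eventually_at_top_linorderI[of 0]) simp
    show "((\<lambda>t. B * exp (- c * t)) \<longlongrightarrow> 0) at_top"
      using \<open>0 < c\<close> by real_asymp
  qed
  then have "((\<lambda>t. - (\<Sum>y<N. forests_weight_to k (ring_arcs N) (N - 2) x y * u t y) / s) \<longlongrightarrow>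
      - (\<Sum>y<N. forests_weight_to k (ring_arcs N) (N - 2) x y * 0) / s) at_top"
    using s by (intro tendsto_intros) auto
  then have lim: "(F \<longlongrightarrow> 0) at_top"
    by (simp add: F_def[abs_def] forest_operator_def)
  have "((\<lambda>t. u t x) has_integral - F 0) {0..}"
    by (rule has_integral_exponentially_bounded[OF F' bound[OF assms(7)] \<open>0 < c\<close> lim])
  moreover have "- F 0 = (\<Sum>y<N. total_weight k (double_rooted_trees_to N x y) * f y)
      / total_weight k (rooted_trees N)"
    by (simp add: F_def u_def semigroup_exp_0[abs_def] forest_operator_def s_def
        total_weight_rooted_trees[OF N] total_weight_double_rooted_trees_to[OF N])
  ultimately show ?thesis
    unfolding quasipotential_def u_def by (metis has_integral_integrable integral_unique)
qed

end
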